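(* Let $a=(a_n)_{n\in\mathbb{N}}$ and $b=(b_n)_{n\in\mathbb{N}}$ be elements of $\ell_1$ over $\mathbb{K}$. Then $a\perp_B b$ if and only if $$\left|\sum_{n=1}^\infty\overline{\operatorname{sgn}(a_n)}\,b_n\right|\le\sum_{n:\,a_n=0}|b_n|,$$ where a sum over an empty set is defined to be $0$.
   Context: $\mathbb{K}$ is $\mathbb{R}$ or $\mathbb{C}$. $\ell_1$ is the space of absolutely summable sequences in $\mathbb{K}$ with norm $\|a\|_1=\sum_n|a_n|$. $\operatorname{sgn}(x)=x/|x|$ for $x\neq0$ and $\operatorname{sgn}(0)=0$. $a\perp_B b$ (Birkhoff-James orthogonality) means $\|a+\lambda b\|_1\ge\|a\|_1$ for all $\lambda\in\mathbb{K}$. *)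

theory Defs
  imports "HOL-Analysis.Analysis"
begin

text \<open>Sequences are indexed from 0. The scalar field is the type \<open>'a\<close>, to be instantiated with
  \<^typ>\<open>real\<close> or \<^typ>\<open>complex\<close>. The library's \<^const>\<open>sgn\<close> is \<open>x / |x|\<close> for nonzero \<open>x\<close>
  and 0 at 0 on both types.\<close>

definition l1 :: "(nat \<Rightarrow> 'a::real_normed_field) set" where
  "l1 = {a. summable (\<lambda>n. norm (a n))}"

definition l1_norm :: "(nat \<Rightarrow> 'a::real_normed_field) \<Rightarrow> real" where
  "l1_norm a = (\<Sum>n. norm (a n))"

text \<open>The scalar \<open>c\<close> ranges over all of \<open>'a\<close>, so the relation depends on the scalar field.
  It is meaningful only for elements of \<^const>\<open>l1\<close>, as \<^const>\<open>l1_norm\<close> is unspecified elsewhere.\<close>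

definition birkhoff_orthogonal ::
    "(nat \<Rightarrow> 'a::real_normed_field) \<Rightarrow> (nat \<Rightarrow> 'a) \<Rightarrow> bool" (infix "\<bottom>\<^sub>B" 50) where
  "a \<bottom>\<^sub>B b \<longleftrightarrow> (\<forall>c. l1_norm (\<lambda>n. a n + c * b n) \<ge> l1_norm a)"

end

theory Submission
  imports Defs
begin

text \<open>
  The function \<open>t \<mapsto> l1_norm (a + t c b)\<close> of the real variable \<open>t\<close> is convex, so it has its minimum
  over \<open>t \<ge> 0\<close> at \<open>0\<close> exactly when its right derivative at \<open>0\<close> is nonnegative; and \<open>a\<close> is
  orthogonal to \<open>b\<close> exactly when this holds for every scalar \<open>c\<close>. The right derivative can be
  computed term by term: the norm of the scalar field has slope \<open>Re (cnj (sgn x) * y)\<close> at a point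
  \<open>x \<noteq> 0\<close> in the direction \<open>y\<close>, and slope \<open>norm y\<close> at \<open>x = 0\<close>. Limit and summation may be
  exchanged since the difference quotients of the \<open>n\<close>-th term are dominated by \<open>norm (c * b n)\<close>
  (Tannery's theorem). With \<open>Z = (\<Sum>n. cnj (sgn (a n)) * b n)\<close> and \<open>S\<close> the sum of \<open>norm (b n)\<close> over
  the zeros of \<open>a\<close>, orthogonality therefore means that \<open>Re (c * Z) + norm c * S \<ge> 0\<close> for all
  \<open>c\<close>. Choosing \<open>c\<close> so that \<open>c * Z\<close> points in the negative real direction shows that this says
  \<open>norm Z \<le> S\<close>.

  The real inner product \<open>inner x y\<close> is \<open>Re (cnj x * y)\<close> on the complex numbers and \<open>x * y\<close>
  on the reals. Phrased with \<open>inner\<close>, everything up to the last step is the same for both fields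
  and is proved once, in the lemma \<open>birkhoff_orthogonal_iff_inner_sum\<close>.
\<close>

text \<open>The right derivative at \<open>0\<close> of the function \<open>t \<mapsto> norm (x + t y)\<close>.\<close>

definition norm_slope :: "'a::real_inner \<Rightarrow> 'a \<Rightarrow> real" where
  "norm_slope x y = (if x = 0 then norm y else inner (sgn x) y)"

lemma inner_sgn_self: "inner (sgn x) x = norm (x::'a::real_inner)"
  by (cases "x = 0") (simp_all add: sgn_div_norm dot_square_norm power2_eq_square)

lemma abs_inner_sgn_le: "\<bar>inner (sgn x) y\<bar> \<le> norm (y::'a::real_inner)"
  using Cauchy_Schwarz_ineq2[of "sgn x" y] by (cases "x = 0") (auto simp: norm_sgn)

text \<open>The subgradient inequality: a convex function lies above its one-sided tangents.\<close>

lemma norm_add_ge_norm_slope: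
  fixes x y :: "'a::real_inner"
  shows "norm x + norm_slope x y \<le> norm (x + y)"
proof (cases "x = 0")
  case False
  then have "norm x + norm_slope x y = inner (sgn x) (x + y)"
    by (simp add: norm_slope_def inner_add_right inner_sgn_self)
  also have "\<dots> \<le> norm (x + y)"
    using abs_inner_sgn_le[of x "x + y"] by linarith
  finally show ?thesis .
qed (simp add: norm_slope_def)

lemma norm_difference_quotient_tendsto:
  fixes x y :: "'a::real_inner"
  shows "((\<lambda>t. (norm (x + t *\<^sub>R y) - norm x) / t) \<longlongrightarrow> norm_slope x y) (at_right 0)"
proof (cases "x = 0")
  case True
  have "\<forall>\<^sub>F t in at_right 0. (norm (x + t *\<^sub>R y) - norm x) / t = norm_slope x y"
    using eventually_at_right_less[of "0::real"]
    by eventually_elim (simp add: True norm_slope_def)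
  then show ?thesis
    by (rule tendsto_eventually)
next
  case False
  have "((\<lambda>t. norm (x + t *\<^sub>R y)) has_derivative (\<lambda>t. inner (t *\<^sub>R y) (sgn x))) (at 0)"
    by (rule has_derivative_compose[of "\<lambda>t. x + t *\<^sub>R y", where g = norm])
       (auto intro!: derivative_eq_intros has_derivative_norm False)
  then have "((\<lambda>t. norm (x + t *\<^sub>R y)) has_real_derivative inner (sgn x) y) (at 0)"
    by (rule has_derivative_imp_has_field_derivative) (simp add: inner_commute)
  then have "((\<lambda>t. (norm (x + t *\<^sub>R y) - norm x) / t) \<longlongrightarrow> inner (sgn x) y) (at 0)"
    by (simp add: has_field_derivative_iff)
  then show ?thesis
    using False by (auto simp: norm_slope_def intro: tendsto_within_subset)
qed

lemma abs_norm_slope_le: "\<bar>norm_slope x y\<bar> \<le> norm y"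
  by (simp add: norm_slope_def abs_inner_sgn_le)

lemma summable_norm_slope:
  assumes "summable (\<lambda>n. norm (b n))"
  shows "summable (\<lambda>n. norm_slope (a n) (b n))"
  by (rule summable_comparison_test'[OF assms, of 0]) (simp add: abs_norm_slope_le)

lemma summable_norm_add:
  fixes a b :: "nat \<Rightarrow> 'a::real_normed_vector"
  assumes "summable (\<lambda>n. norm (a n))" "summable (\<lambda>n. norm (b n))"
  shows "summable (\<lambda>n. norm (a n + b n))"
  by (rule summable_comparison_test'[OF summable_add[OF assms], of 0]) (simp add: norm_triangle_ineq)

lemma suminf_norm_add_ge_norm_slope:
  fixes a b :: "nat \<Rightarrow> 'a::real_inner"
  assumes "summable (\<lambda>n. norm (a n))" "summable (\<lambda>n. norm (b n))"
  shows "(\<Sum>n. norm (a n)) + (\<Sum>n. norm_slope (a n) (b n)) \<le> (\<Sum>n. norm (a n + b n))"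
  unfolding suminf_add[OF assms(1) summable_norm_slope[OF assms(2)]]
  by (intro suminf_le norm_add_ge_norm_slope summable_add summable_norm_slope summable_norm_add assms)

text \<open>
  The reverse triangle inequality bounds the difference quotients of the \<open>n\<close>-th term by
  \<open>norm (b n)\<close>, uniformly in \<open>t\<close>, so the termwise limits may be summed.
\<close>

lemma suminf_norm_difference_quotient_tendsto:
  fixes a b :: "nat \<Rightarrow> 'a::real_inner"
  assumes "summable (\<lambda>n. norm (a n))" "summable (\<lambda>n. norm (b n))"
  shows "((\<lambda>t. ((\<Sum>n. norm (a n + t *\<^sub>R b n)) - (\<Sum>n. norm (a n))) / t)
           \<longlongrightarrow> (\<Sum>n. norm_slope (a n) (b n))) (at_right 0)"
proof -
  have dominated: "norm ((norm (x + t *\<^sub>R y) - norm x) / t) \<le> norm y" if "0 < t" for t and x y :: 'a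
    using norm_triangle_ineq3[of "x + t *\<^sub>R y" x] that by (simp add: field_simps)
  have "\<forall>\<^sub>F (n, t) in at_top \<times>\<^sub>F at_right 0.
          norm ((norm (a n + t *\<^sub>R b n) - norm (a n)) / t) \<le> norm (b n)"
    unfolding case_prod_beta
    by (rule eventually_mono[OF eventually_prodI[OF always_eventually
          eventually_at_right_less[of "0::real"]], where P1 = "\<lambda>_. True"])
       (use dominated in auto)
  then have "((\<lambda>t. \<Sum>n. (norm (a n + t *\<^sub>R b n) - norm (a n)) / t)
               \<longlongrightarrow> (\<Sum>n. norm_slope (a n) (b n))) (at_right 0)"
    using tannerys_theorem[OF norm_difference_quotient_tendsto _ assms(2), where x2 = a and y2 = b]
    by (metis trivial_limit_at_right_real)
  moreover have "(\<Sum>n. (norm (a n + t *\<^sub>R b n) - norm (a n)) / t) =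
      ((\<Sum>n. norm (a n + t *\<^sub>R b n)) - (\<Sum>n. norm (a n))) / t" for t
  proof -
    have "summable (\<lambda>n. norm (t *\<^sub>R b n))"
      using assms(2) by (simp add: summable_mult)
    then have sum_ab: "summable (\<lambda>n. norm (a n + t *\<^sub>R b n))"
      by (rule summable_norm_add[OF assms(1)])
    show ?thesis
      by (simp only: suminf_divide[OF summable_diff[OF sum_ab assms(1)]]
          suminf_diff[OF sum_ab assms(1)])
  qed
  ultimately show ?thesis by simp
qed

text \<open>
  Orthogonality makes the difference quotients along each ray nonnegative, hence also their limit.
  Conversely the subgradient inequality, summed over all terms, turns a nonnegative slope in the
  direction \<open>c * b\<close> into the inequality required of the scalar \<open>c\<close>.
\<close>

lemma birkhoff_orthogonal_iff_norm_slope: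
  fixes a b :: "nat \<Rightarrow> 'a::{real_normed_field,real_inner}"
  assumes "a \<in> l1" "b \<in> l1"
  shows "a \<bottom>\<^sub>B b \<longleftrightarrow> (\<forall>c. 0 \<le> (\<Sum>n. norm_slope (a n) (c * b n)))"
proof -
  have sum_a: "summable (\<lambda>n. norm (a n))" and sum_b: "summable (\<lambda>n. norm (c * b n))" for c
    using assms by (auto simp: l1_def norm_mult intro: summable_mult)
  show ?thesis
  proof (intro iffI allI)
    fix c
    assume orth: "a \<bottom>\<^sub>B b"
    have "(\<Sum>n. norm (a n)) \<le> (\<Sum>n. norm (a n + t *\<^sub>R (c * b n)))" for t
      using orth[unfolded birkhoff_orthogonal_def l1_norm_def, rule_format, of "of_real t * c"]
      by (simp add: scaleR_conv_of_real mult.assoc)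
    then have "\<forall>\<^sub>F t in at_right 0.
        0 \<le> ((\<Sum>n. norm (a n + t *\<^sub>R (c * b n))) - (\<Sum>n. norm (a n))) / t"
      using eventually_at_right_less[of "0::real"] by (auto elim!: eventually_mono)
    then show "0 \<le> (\<Sum>n. norm_slope (a n) (c * b n))"
      by (rule tendsto_lowerbound[OF suminf_norm_difference_quotient_tendsto[OF sum_a sum_b]]) simp
  next
    assume slope_nonneg: "\<forall>c. 0 \<le> (\<Sum>n. norm_slope (a n) (c * b n))"
    show "a \<bottom>\<^sub>B b"
      unfolding birkhoff_orthogonal_def l1_norm_def
    proof
      fix c
      show "(\<Sum>n. norm (a n)) \<le> (\<Sum>n. norm (a n + c * b n))"
        using suminf_norm_add_ge_norm_slope[OF sum_a sum_b[of c]] slope_nonneg[rule_format, of c]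
        by linarith
    qed
  qed
qed

text \<open>
  The slope splits into a linear part, carried by the indices with \<open>a n \<noteq> 0\<close>, and a part that is
  absolutely homogeneous in \<open>c\<close>, carried by the zeros of \<open>a\<close>. Since \<open>sgn 0 = 0\<close>, the linear part
  can be summed over all indices.
\<close>

lemma birkhoff_orthogonal_iff_inner_sum:
  fixes a b :: "nat \<Rightarrow> 'a::{real_normed_field,real_inner}"
  assumes "a \<in> l1" "b \<in> l1"
  shows "a \<bottom>\<^sub>B b \<longleftrightarrow>
    (\<forall>c. 0 \<le> (\<Sum>n. inner (sgn (a n)) (c * b n)) + norm c * (\<Sum>\<^sub>\<infinity>n\<in>{n. a n = 0}. norm (b n)))"
proof -
  define zero_part where "zero_part n = (if a n = 0 then norm (b n) else 0)" for n
  have sum_b: "summable (\<lambda>n. norm (c * b n))" for c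
    using assms by (auto simp: l1_def norm_mult intro: summable_mult)
  have sum_zero: "summable zero_part"
    by (rule summable_comparison_test'[OF sum_b[of 1], of 0]) (simp add: zero_part_def)
  have sum_inner: "summable (\<lambda>n. inner (sgn (a n)) (c * b n))" for c
    by (rule summable_comparison_test'[OF sum_b[of c], of 0]) (simp add: abs_inner_sgn_le)
  have "(\<Sum>\<^sub>\<infinity>n\<in>{n. a n = 0}. norm (b n)) = infsum zero_part UNIV"
    by (rule infsum_cong_neutral) (auto simp: zero_part_def)
  also have "\<dots> = suminf zero_part"
    using sum_zero
    by (intro infsumI sums_nonneg_imp_has_sum summable_sums) (auto simp: zero_part_def)
  finally have zero_sum: "(\<Sum>\<^sub>\<infinity>n\<in>{n. a n = 0}. norm (b n)) = suminf zero_part" .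
  have "norm_slope (a n) (c * b n) = inner (sgn (a n)) (c * b n) + norm c * zero_part n" for c n
    by (simp add: norm_slope_def zero_part_def norm_mult)
  then have "(\<Sum>n. norm_slope (a n) (c * b n)) =
      (\<Sum>n. inner (sgn (a n)) (c * b n)) + norm c * suminf zero_part" for c
    using sum_zero sum_inner
    by (simp add: suminf_add[symmetric] suminf_mult summable_mult)
  then show ?thesis
    by (simp add: birkhoff_orthogonal_iff_norm_slope[OF assms] zero_sum)
qed

text \<open>
  As \<open>c\<close> runs over a circle about the origin, the minimum of \<open>Re (c * z)\<close> is \<open>- cmod c * cmod z\<close>.
\<close>

lemma norm_le_iff_Re_mult_nonneg:
  assumes "0 \<le> S"
  shows "(\<forall>c. 0 \<le> Re (c * z) + cmod c * S) \<longleftrightarrow> cmod z \<le> S"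
proof
  assume *: "\<forall>c. 0 \<le> Re (c * z) + cmod c * S"
  \<comment> \<open>The scalar \<open>- cnj z\<close> turns \<open>z\<close> into the negative real direction.\<close>
  have "cmod z * cmod z \<le> cmod z * S"
    using *[rule_format, of "- cnj z"] cmod_power2[of z]
    by (simp add: power2_eq_square)
  then show "cmod z \<le> S"
    using assms by (cases "z = 0") auto
next
  assume "cmod z \<le> S"
  then have "cmod (c * z) \<le> cmod c * S" for c
    by (simp add: norm_mult mult_left_mono)
  then have "\<bar>Re (c * z)\<bar> \<le> cmod c * S" for c
    using abs_Re_le_cmod order_trans by blast
  then show "\<forall>c. 0 \<le> Re (c * z) + cmod c * S"
    by (smt (verit))
qed

lemma abs_le_iff_mult_nonneg:
  fixes S z :: real
  assumes "0 \<le> S"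
  shows "(\<forall>c. 0 \<le> c * z + \<bar>c\<bar> * S) \<longleftrightarrow> \<bar>z\<bar> \<le> S"
proof
  assume "\<forall>c. 0 \<le> c * z + \<bar>c\<bar> * S"
  from this[rule_format, of 1] this[rule_format, of "-1"] show "\<bar>z\<bar> \<le> S"
    by simp
next
  assume "\<bar>z\<bar> \<le> S"
  then have "\<bar>c * z\<bar> \<le> \<bar>c\<bar> * S" for c
    by (simp add: abs_mult mult_left_mono)
  then show "\<forall>c. 0 \<le> c * z + \<bar>c\<bar> * S"
    by (smt (verit))
qed

theorem theorem3p3:
  "(\<forall>a \<in> (l1 :: (nat \<Rightarrow> real) set). \<forall>b \<in> l1.
      a \<bottom>\<^sub>B b \<longleftrightarrow>
      \<bar>\<Sum>n. sgn (a n) * b n\<bar> \<le> (\<Sum>\<^sub>\<infinity>n\<in>{n. a n = 0}. \<bar>b n\<bar>)) \<and>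
   (\<forall>a \<in> (l1 :: (nat \<Rightarrow> complex) set). \<forall>b \<in> l1.
      a \<bottom>\<^sub>B b \<longleftrightarrow>
      cmod (\<Sum>n. cnj (sgn (a n)) * b n) \<le> (\<Sum>\<^sub>\<infinity>n\<in>{n. a n = 0}. cmod (b n)))"
proof (intro conjI ballI)
  fix a b :: "nat \<Rightarrow> real"
  assume l1: "a \<in> l1" "b \<in> l1"
  have "summable (\<lambda>n. sgn (a n) * b n)"
    by (rule summable_comparison_test'[of "\<lambda>n. \<bar>b n\<bar>" 0])
       (use l1 in \<open>auto simp: l1_def abs_mult abs_sgn_eq\<close>)
  then have "(\<Sum>n. inner (sgn (a n)) (c * b n)) = c * (\<Sum>n. sgn (a n) * b n)" for c
    by (simp add: suminf_mult[symmetric] mult.left_commute)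
  then show "a \<bottom>\<^sub>B b \<longleftrightarrow>
      \<bar>\<Sum>n. sgn (a n) * b n\<bar> \<le> (\<Sum>\<^sub>\<infinity>n\<in>{n. a n = 0}. \<bar>b n\<bar>)"
    by (simp add: birkhoff_orthogonal_iff_inner_sum[OF l1] abs_le_iff_mult_nonneg infsum_nonneg)
next
  fix a b :: "nat \<Rightarrow> complex"
  assume l1: "a \<in> l1" "b \<in> l1"
  have summable: "summable (\<lambda>n. cnj (sgn (a n)) * b n)"
    by (rule summable_comparison_test'[of "\<lambda>n. cmod (b n)" 0])
       (use l1 in \<open>auto simp: l1_def norm_mult norm_sgn\<close>)
  have "(\<Sum>n. inner (sgn (a n)) (c * b n)) = Re (c * (\<Sum>n. cnj (sgn (a n)) * b n))" for c
  proof -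
    have "inner (sgn (a n)) (c * b n) = Re (c * (cnj (sgn (a n)) * b n))" for n
      by (simp add: inner_complex_def algebra_simps)
    then show ?thesis
      using bounded_linear.suminf[OF bounded_linear_Re summable_mult[OF summable]]
      by (simp only: suminf_mult[OF summable])
  qed
  then show "a \<bottom>\<^sub>B b \<longleftrightarrow>
      cmod (\<Sum>n. cnj (sgn (a n)) * b n) \<le> (\<Sum>\<^sub>\<infinity>n\<in>{n. a n = 0}. cmod (b n))"
    by (simp add: birkhoff_orthogonal_iff_inner_sum[OF l1] norm_le_iff_Re_mult_nonneg infsum_nonneg
        del: times_complex.sel)
qed

end
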